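(* Let $G$ be a $2$-simultaneous edge colorable graph, let $xy\in E(G)$, let $k\ge 1$, and let $G'$ be the graph obtained from $G$ by replacing the edge $xy$ by a path $xv_1v_2\cdots v_{2k}y$ where $v_1,\ldots,v_{2k}$ are new vertices not in $V(G)$. Then $G'$ is $2$-simultaneous edge colorable.
   Context: All graphs are finite and simple; $[l]=\{1,\ldots,l\}$. A $2$-simultaneous edge coloring of $G$ is a pair $(c_1,c_2)$ of proper edge colorings $c_i:E(G)\to[l]$ with a common color set such that for every vertex $v$ the sets of colors on edges incident to $v$ are the same under $c_1$ and $c_2$, and $c_1(e)\ne c_2(e)$ for every edge $e$; $G$ is $2$-simultaneous edge colorable if such a pair exists for some $l$. *)

theory Defs
  imports Main
begin

record 'a graph =
  verts :: "'a set"
  edges :: "'a set set"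

definition simple_graph :: "'a graph \<Rightarrow> bool" where
  "simple_graph G \<longleftrightarrow>
     finite (verts G) \<and> (\<forall>e \<in> edges G. e \<subseteq> verts G \<and> card e = 2)"

definition incident_edges :: "'a graph \<Rightarrow> 'a \<Rightarrow> 'a set set" where
  "incident_edges G v = {e \<in> edges G. v \<in> e}"

(* Colorings are total functions; their values outside the edge set are irrelevant. *)
definition proper_edge_coloring :: "'a graph \<Rightarrow> nat \<Rightarrow> ('a set \<Rightarrow> nat) \<Rightarrow> bool" where
  "proper_edge_coloring G l c \<longleftrightarrow>
     (\<forall>e \<in> edges G. c e \<in> {1..l}) \<and>
     (\<forall>e \<in> edges G. \<forall>f \<in> edges G. e \<noteq> f \<and> e \<inter> f \<noteq> {} \<longrightarrow> c e \<noteq> c f)"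

definition two_simultaneous_edge_coloring ::
    "'a graph \<Rightarrow> nat \<Rightarrow> ('a set \<Rightarrow> nat) \<Rightarrow> ('a set \<Rightarrow> nat) \<Rightarrow> bool" where
  "two_simultaneous_edge_coloring G l c1 c2 \<longleftrightarrow>
     proper_edge_coloring G l c1 \<and> proper_edge_coloring G l c2 \<and>
     (\<forall>v \<in> verts G. c1 ` incident_edges G v = c2 ` incident_edges G v) \<and>
     (\<forall>e \<in> edges G. c1 e \<noteq> c2 e)"

definition two_simultaneous_edge_colorable :: "'a graph \<Rightarrow> bool" where
  "two_simultaneous_edge_colorable G \<longleftrightarrow>
     (\<exists>l c1 c2. two_simultaneous_edge_coloring G l c1 c2)"

definition path_edges :: "'a list \<Rightarrow> 'a set set" where
  "path_edges p = {{p ! i, p ! Suc i} | i. Suc i < length p}"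

(* vs lists the inner vertices of the new path, in order from x to y. *)
definition replace_edge_by_path :: "'a graph \<Rightarrow> 'a \<Rightarrow> 'a \<Rightarrow> 'a list \<Rightarrow> 'a graph" where
  "replace_edge_by_path G x y vs =
     \<lparr>verts = verts G \<union> set vs,
      edges = (edges G - {{x, y}}) \<union> path_edges (x # vs @ [y])\<rparr>"

lemma simple_graph_replace_edge_by_path:
  assumes G: "simple_graph G" and xy: "{x, y} \<in> edges G"
    and vs: "distinct vs" "set vs \<inter> verts G = {}"
  shows "simple_graph (replace_edge_by_path G x y vs)"
proof -
  let ?p = "x # vs @ [y]"
  have "{x, y} \<subseteq> verts G" "card {x, y} = 2"
    using G xy by (auto simp: simple_graph_def)
  then have inV: "x \<in> verts G" "y \<in> verts G" and "x \<noteq> y" by auto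
  then have dist: "distinct ?p" using vs by auto
  have "e \<subseteq> verts G \<union> set vs \<and> card e = 2" if e: "e \<in> path_edges ?p" for e
  proof -
    obtain i where i: "Suc i < length ?p" and e: "e = {?p ! i, ?p ! Suc i}"
      using e unfolding path_edges_def by blast
    have "?p ! i \<noteq> ?p ! Suc i"
      using nth_eq_iff_index_eq[OF dist, of i "Suc i"] i by simp
    moreover have "?p ! i \<in> set ?p" "?p ! Suc i \<in> set ?p"
      using nth_mem[OF i] nth_mem[OF Suc_lessD[OF i]] by blast+
    ultimately show ?thesis unfolding e using inV by auto
  qed
  then show ?thesis
    using G by (fastforce simp: simple_graph_def replace_edge_by_path_def)
qed

end

(* Let a and b be the two colors of the edge xy. Every inner vertex of the path has degree 2, so
   the two colors must be swapped from each path edge to the next: the first coloring reads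
   a, b, a, ..., a along the path and the second one reads b, a, b, ..., b. As the number of path
   edges is odd, both end edges carry the colors of xy, and nothing changes at the old vertices. *)

theory Submission
  imports Defs
begin

locale edge_subdivision =
  fixes G :: "'a graph" and x y :: 'a and vs :: "'a list"
  assumes simple: "simple_graph G"
    and edge: "{x, y} \<in> edges G"
    and even_length: "even (length vs)"
    and nonempty: "vs \<noteq> []"
    and distinct_vs: "distinct vs"
    and fresh: "set vs \<inter> verts G = {}"
begin

abbreviation "G' \<equiv> replace_edge_by_path G x y vs"
abbreviation "p \<equiv> x # vs @ [y]"

definition path_edge :: "nat \<Rightarrow> 'a set" where
  "path_edge i = {p ! i, p ! Suc i}"

text \<open>A coloring is a function of an edge as a set, so the position along the path has to be
  recovered from that set. The value is meaningful only on path edges.\<close>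

definition path_index :: "'a set \<Rightarrow> nat" where
  "path_index = inv_into {..length vs} path_edge"

text \<open>The parameter \<open>b\<close> stands for the color of \<open>{x, y}\<close> under the
  other coloring of the pair.\<close>

definition extend_coloring :: "('a set \<Rightarrow> nat) \<Rightarrow> nat \<Rightarrow> 'a set \<Rightarrow> nat" where
  "extend_coloring c b e =
     (if e \<in> edges G then c e else if even (path_index e) then c {x, y} else b)"

lemma edge_subset: "e \<in> edges G \<Longrightarrow> e \<subseteq> verts G"
  using simple by (auto simp: simple_graph_def)

lemma endpoints: "x \<in> verts G" "y \<in> verts G" "x \<noteq> y"
proof -
  have "card {x, y} = 2" using simple edge by (auto simp: simple_graph_def)
  then show "x \<noteq> y" by auto
qed (use edge_subset[OF edge] in auto)

lemma distinct_path: "distinct p"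
  using endpoints distinct_vs fresh by auto

lemma path_nth_eq_iff:
  "i \<le> Suc (length vs) \<Longrightarrow> j \<le> Suc (length vs) \<Longrightarrow> p ! i = p ! j \<longleftrightarrow> i = j"
  using nth_eq_iff_index_eq[OF distinct_path, of i j] by simp

lemma path_nth_last: "p ! Suc (length vs) = y"
  by simp

lemma path_nth_in_verts_iff:
  assumes "i \<le> Suc (length vs)"
  shows "p ! i \<in> verts G \<longleftrightarrow> i = 0 \<or> i = Suc (length vs)"
proof (cases "0 < i \<and> i \<le> length vs")
  case True
  then have "p ! i \<in> set vs" by (auto simp: nth_Cons' nth_append)
  then show ?thesis using fresh True by auto
next
  case False
  then have "i = 0 \<or> i = Suc (length vs)" using assms by auto
  then show ?thesis using endpoints by auto
qed

text \<open>Vertices on the path are distinct, and a crossed match of the endpoints would force both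
  \<open>i = Suc j\<close> and \<open>j = Suc i\<close>.\<close>

lemma inj_path_edge: "inj_on path_edge {..length vs}"
proof (rule inj_onI)
  fix i j assume "i \<in> {..length vs}" "j \<in> {..length vs}" "path_edge i = path_edge j"
  then show "i = j"
    using path_nth_eq_iff[of i j] path_nth_eq_iff[of i "Suc j"]
      path_nth_eq_iff[of "Suc i" j] path_nth_eq_iff[of "Suc i" "Suc j"]
    unfolding path_edge_def doubleton_eq_iff by auto
qed

lemma path_index_path_edge: "i \<le> length vs \<Longrightarrow> path_index (path_edge i) = i"
  unfolding path_index_def by (simp add: inv_into_f_f[OF inj_path_edge])

text \<open>Since \<open>vs\<close> is nonempty, every path edge has an inner, hence fresh,
  endpoint. With no inner vertex the only path edge would be \<open>{x, y}\<close> itself.\<close>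

lemma path_edge_not_old:
  assumes "i \<le> length vs"
  shows "path_edge i \<notin> edges G"
proof
  assume "path_edge i \<in> edges G"
  then have "p ! i \<in> verts G" "p ! Suc i \<in> verts G"
    using edge_subset unfolding path_edge_def by blast+
  then show False
    using assms nonempty path_nth_in_verts_iff[of i] path_nth_in_verts_iff[of "Suc i"] by auto
qed

lemma extend_coloring_old [simp]: "e \<in> edges G \<Longrightarrow> extend_coloring c b e = c e"
  by (simp add: extend_coloring_def)

lemma extend_coloring_path_edge [simp]:
  "i \<le> length vs \<Longrightarrow>
     extend_coloring c b (path_edge i) = (if even i then c {x, y} else b)"
  by (simp add: extend_coloring_def path_edge_not_old path_index_path_edge)

lemma edges_subdivided: "edges G' = (edges G - {{x, y}}) \<union> path_edge ` {..length vs}"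
proof -
  have "path_edges p = path_edge ` {..length vs}"
    unfolding path_edges_def path_edge_def by (auto simp: less_Suc_eq_le)
  then show ?thesis by (simp add: replace_edge_by_path_def)
qed

lemma verts_subdivided: "verts G' = verts G \<union> set vs"
  by (simp add: replace_edge_by_path_def)

lemma subdivided_edge_cases:
  assumes "e \<in> edges G'"
  obtains "e \<in> edges G" "e \<noteq> {x, y}" | i where "i \<le> length vs" "e = path_edge i"
  using assms unfolding edges_subdivided by auto

text \<open>Inner vertices are fresh, so the path touches the old graph only through its first and
  last edges. Their indices, 0 and \<open>length vs\<close>, are both even.\<close>

lemma old_vertex_in_path_edge_iff:
  assumes "v \<in> verts G" "i \<le> length vs"
  shows "v \<in> path_edge i \<longleftrightarrow> v = x \<and> i = 0 \<or> v = y \<and> i = length vs"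
  using assms path_nth_in_verts_iff[of i] path_nth_in_verts_iff[of "Suc i"] path_nth_last
  unfolding path_edge_def by auto

lemma path_vertex_in_path_edge_iff:
  assumes "j \<le> Suc (length vs)" "i \<le> length vs"
  shows "p ! j \<in> path_edge i \<longleftrightarrow> j = i \<or> j = Suc i"
  using assms path_nth_eq_iff[of j i] path_nth_eq_iff[of j "Suc i"]
  unfolding path_edge_def by auto

text \<open>Three kinds of adjacent pairs occur: two old edges inherit the property from
  \<open>c\<close>, an old edge and an end edge of the path behave like that edge and
  \<open>{x, y}\<close>, and two path edges alternate between distinct colors.\<close>

lemma proper_extend_coloring:
  assumes c: "proper_edge_coloring G l c" and b: "b \<in> {1..l}" "c {x, y} \<noteq> b"
  shows "proper_edge_coloring G' l (extend_coloring c b)"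
proof -
  let ?c = "extend_coloring c b"
  have proper: "c e \<noteq> c f" if "e \<in> edges G" "f \<in> edges G" "e \<noteq> f" "v \<in> e" "v \<in> f" for e f v
    using c that unfolding proper_edge_coloring_def by blast
  have range: "c e \<in> {1..l}" if "e \<in> edges G" for e
    using c that unfolding proper_edge_coloring_def by blast
  have range': "?c e \<in> {1..l}" if "e \<in> edges G'" for e
    using that
  proof (cases rule: subdivided_edge_cases)
    case 1
    then show ?thesis using range by simp
  next
    case (2 i)
    then show ?thesis using range[OF edge] b by simp
  qed
  have mixed: "?c e \<noteq> ?c (path_edge i)"
    if "e \<in> edges G" "e \<noteq> {x, y}" "i \<le> length vs" "v \<in> e" "v \<in> path_edge i" for e i v
  proof -
    have "v \<in> verts G" using that edge_subset by blast
    \<comment> \<open>The path edge thus carries the color of \<open>{x, y}\<close>, and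
      \<open>e\<close> also meets \<open>{x, y}\<close> in \<open>v\<close>, so properness of
      \<open>c\<close> separates the two colors.\<close>
    then have "v \<in> {x, y}" "even i"
      using that old_vertex_in_path_edge_iff even_length by auto
    then show ?thesis using proper[OF that(1) edge that(2)] that by simp
  qed
  have "?c e \<noteq> ?c f" if "e \<in> edges G'" "f \<in> edges G'" "e \<noteq> f" and v: "v \<in> e" "v \<in> f"
    for e f v
    using that(1)
  proof (cases rule: subdivided_edge_cases)
    case e: 1
    from that(2) show ?thesis
      by (cases rule: subdivided_edge_cases) (use e mixed proper v \<open>e \<noteq> f\<close> in auto)
  next
    case e: (2 i)
    from that(2) show ?thesis
    proof (cases rule: subdivided_edge_cases)
      case 1
      then show ?thesis using e mixed v by metis
    next
      case f: (2 j)
      then have "i \<noteq> j" using e \<open>e \<noteq> f\<close> by auto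
      \<comment> \<open>Only the edges with index \<open>m\<close> or \<open>m - 1\<close> contain
        \<open>p ! m\<close>, so two distinct ones are consecutive and their indices differ in
        parity.\<close>
      moreover obtain m where "m \<le> Suc (length vs)" "v = p ! m"
        using v(1) e unfolding path_edge_def
        by (metis Suc_le_mono empty_iff insert_iff le_Suc_eq)
      ultimately have "i = Suc j \<or> j = Suc i"
        using v e f path_vertex_in_path_edge_iff[of m i] path_vertex_in_path_edge_iff[of m j]
        by auto
      then show ?thesis using e f b by auto
    qed
  qed
  then show ?thesis
    using range' unfolding proper_edge_coloring_def by blast
qed

text \<open>At \<open>x\<close> and at \<open>y\<close> a single end edge of the path takes the
  place of \<open>{x, y}\<close> and has the same color; at other old vertices no incident edge
  changes.\<close>

lemma colors_at_old_vertex: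
  assumes v: "v \<in> verts G"
  shows "extend_coloring c b ` incident_edges G' v = c ` incident_edges G v"
proof -
  let ?c = "extend_coloring c b"
  let ?P = "{path_edge i |i. i \<le> length vs \<and> v \<in> path_edge i}"
  let ?O = "incident_edges G v - {{x, y}}"
  have "incident_edges G' v = ?O \<union> ?P"
    unfolding incident_edges_def edges_subdivided by auto
  moreover have "?c ` ?O = c ` ?O"
    by (intro image_cong) (auto simp: incident_edges_def)
  moreover have "?c ` ?P = (if v \<in> {x, y} then {c {x, y}} else {})"
  proof -
    have "?P = (if v = x then {path_edge 0} else if v = y then {path_edge (length vs)} else {})"
      using old_vertex_in_path_edge_iff[OF v] endpoints(3) by auto
    then show ?thesis using even_length endpoints(3) by simp
  qed
  ultimately have "?c ` incident_edges G' v
      = c ` ?O \<union> (if v \<in> {x, y} then {c {x, y}} else {})"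
    by (simp only: image_Un)
  also have "\<dots> = c ` incident_edges G v"
    using edge by (auto simp: incident_edges_def)
  finally show ?thesis .
qed

text \<open>The two path edges at an inner vertex have indices of opposite parity. The resulting set
  is symmetric in the two colors, so exchanging their roles does not affect it.\<close>

lemma colors_at_new_vertex:
  assumes v: "v \<in> set vs"
  shows "extend_coloring c b ` incident_edges G' v = {c {x, y}, b}"
proof -
  \<comment> \<open>The shift by one accounts for \<open>x\<close> at the head of \<open>p\<close>;
    the bound on \<open>m\<close> keeps both \<open>m\<close> and \<open>Suc m\<close> valid edge
    indices.\<close>
  obtain m where m: "m < length vs" "v = p ! Suc m"
    using v by (auto simp: in_set_conv_nth nth_append)
  have "v \<notin> e" if "e \<in> edges G" for e
    using that v fresh edge_subset by blast
  then have "incident_edges G' v = {path_edge i |i. i \<le> length vs \<and> v \<in> path_edge i}"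
    unfolding incident_edges_def edges_subdivided by auto
  also have "\<dots> = {path_edge m, path_edge (Suc m)}"
    using m path_vertex_in_path_edge_iff[of "Suc m"] by auto
  finally show ?thesis using m by auto
qed

text \<open>Each extension uses the other coloring's color of \<open>{x, y}\<close> at odd
  positions, so the two alternate in opposite phase and differ on every path edge.\<close>

lemma two_simultaneous_extend_coloring:
  assumes "two_simultaneous_edge_coloring G l c1 c2"
  shows "two_simultaneous_edge_coloring G' l
    (extend_coloring c1 (c2 {x, y})) (extend_coloring c2 (c1 {x, y}))"
proof -
  let ?c1 = "extend_coloring c1 (c2 {x, y})" and ?c2 = "extend_coloring c2 (c1 {x, y})"
  have c: "proper_edge_coloring G l c1" "proper_edge_coloring G l c2"
    "\<And>v. v \<in> verts G \<Longrightarrow> c1 ` incident_edges G v = c2 ` incident_edges G v"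
    "\<And>e. e \<in> edges G \<Longrightarrow> c1 e \<noteq> c2 e"
    using assms unfolding two_simultaneous_edge_coloring_def by auto
  have "c1 {x, y} \<in> {1..l}" "c2 {x, y} \<in> {1..l}"
    using c(1,2) edge unfolding proper_edge_coloring_def by blast+
  then have "proper_edge_coloring G' l ?c1" "proper_edge_coloring G' l ?c2"
    using c(1,2) c(4)[OF edge] by (auto intro!: proper_extend_coloring)
  moreover have "?c1 ` incident_edges G' v = ?c2 ` incident_edges G' v" if "v \<in> verts G'" for v
  proof (cases "v \<in> verts G")
    case True
    then show ?thesis using c(3) by (simp add: colors_at_old_vertex)
  next
    case False
    then show ?thesis
      using that by (simp add: verts_subdivided colors_at_new_vertex insert_commute)
  qed
  moreover have "?c1 e \<noteq> ?c2 e" if "e \<in> edges G'" for e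
    using that by (cases rule: subdivided_edge_cases) (use c(4) c(4)[OF edge] in auto)
  ultimately show ?thesis
    unfolding two_simultaneous_edge_coloring_def by blast
qed

end

theorem theorem3p2:
  fixes G :: "'a graph" and x y :: 'a and k :: nat and vs :: "'a list"
  assumes "simple_graph G"
    and "two_simultaneous_edge_colorable G"
    and "{x, y} \<in> edges G"
    and "k \<ge> 1"
    and "length vs = 2 * k"
    and "distinct vs"
    and "set vs \<inter> verts G = {}"
  shows "two_simultaneous_edge_colorable (replace_edge_by_path G x y vs)"
proof -
  interpret edge_subdivision G x y vs
    using assms by unfold_locales auto
  show ?thesis
    using assms(2) two_simultaneous_extend_coloring
    unfolding two_simultaneous_edge_colorable_def by blast
qed

end
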